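(* Let $U$ be a generalized Jordan triple system of second order over a field $\Phi$ of characteristic different from $2,3,5$, let $e\in U$ be a tripotent, i.e. $(eee)=e$, and define linear operators on $U$ by $L(x)=(eex)$, $R(x)=(xee)$, $Q(x)=(exe)$. Then $U$ is a direct sum of ten subspaces $$U=U_{00}\oplus U_{\frac12\frac12}\oplus U_{11}^{+}\oplus U_{11}^{-}\oplus U_{\frac32\frac32}\oplus U_{-\frac12 0}\oplus U_{01}\oplus U_{\frac12 2}\oplus U_{13}^{+}\oplus U_{13}^{-},$$ (some possibly zero), with the following properties: 1) $La=\lambda a$ and $Ra=\mu a$ for every $a$ in $U_{\lambda\mu}$ (respectively in $U_{\lambda\mu}^{\pm}$); 2) $Q(a)=0$ for all $a\in U_{00},\,U_{\frac12\frac12},\,U_{01},\,U_{-\frac12 0}$; 3) $Q(a)=\pm a$ if $a\in U_{11}^{\pm}$, and $Q(a)=\pm 3a$ if $a\in U_{13}^{\pm}$; 4) the map $\tau a=\frac{1}{\sqrt3}Q(a)$, for $a\in U_{\frac32\frac32}$ or $a\in U_{\frac12 2}$ (where $\sqrt3$ is a fixed square root of $3$, presupposed to lie in $\Phi$ for this item), is a one-to-one correspondence between the subspaces $U_{\frac32\frac32}$ and $U_{\frac12 2}$. If in addition the triple system is weakly commutative, then $U$ is a direct sum of only six of these subspaces, $$U=U_{00}\oplus U_{\frac12\frac12}\oplus U_{11}^{+}\oplus U_{11}^{-}\oplus U_{01}\oplus U_{13}^{-},$$ and $L,R,Q$ act on them as described in 1), 2), 3).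
   Context: A generalized Jordan triple system of second order is a vector space $U$ over $\Phi$ with a trilinear product $(xyz)$ satisfying, for all elements, $$(ab(cdf))=((abc)df)-(c(bad)f)+(cd(abf)),$$ $$[((avb)uc)-(cu(avb))-(cv(aub))-(a(vcu)b)]_{a,b}=0,$$ where $[F(a,b)]_{a,b}=F(a,b)-F(b,a)$ denotes alternation in $a$ and $b$. It is weakly commutative if $(yx(yyy))=((yyy)xy)$ for all $x,y\in U$. For $\lambda,\mu\in\Phi$, $U_{\lambda\mu}=\{a\in U: La=\lambda a,\ Ra=\mu a\}$; $U_{11}^{\pm}=\{a\in U_{11}:Q(a)=\pm a\}$ and $U_{13}^{\pm}=\{a\in U_{13}:Q(a)=\pm3a\}$. *)

theory Defs
  imports Complex_Main
begin

definition alternation :: "('u \<Rightarrow> 'u \<Rightarrow> 'v::minus) \<Rightarrow> 'u \<Rightarrow> 'u \<Rightarrow> 'v" where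
  "alternation F a b = F a b - F b a"

locale gen_jordan_triple_2 = vector_space scale
  for scale :: "'k::field \<Rightarrow> 'u::ab_group_add \<Rightarrow> 'u" +
  fixes t :: "'u \<Rightarrow> 'u \<Rightarrow> 'u \<Rightarrow> 'u"
  assumes linear_1: "Vector_Spaces.linear scale scale (\<lambda>x. t x y z)"
    and linear_2: "Vector_Spaces.linear scale scale (\<lambda>y. t x y z)"
    and linear_3: "Vector_Spaces.linear scale scale (\<lambda>z. t x y z)"
    and derivation_identity:
      "t a b (t c d f) = t (t a b c) d f - t c (t b a d) f + t c d (t a b f)"
    and second_order_identity:
      "alternation (\<lambda>a b. t (t a v b) u c - t c u (t a v b) - t c v (t a u b)
                          - t a (t v c u) b) a b = 0"

definition weakly_commutative :: "('u \<Rightarrow> 'u \<Rightarrow> 'u \<Rightarrow> 'u) \<Rightarrow> bool" where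
  "weakly_commutative t \<longleftrightarrow> (\<forall>x y. t y x (t y y y) = t (t y y y) x y)"

definition tripotent :: "('u \<Rightarrow> 'u \<Rightarrow> 'u \<Rightarrow> 'u) \<Rightarrow> 'u \<Rightarrow> bool" where
  "tripotent t e \<longleftrightarrow> t e e e = e"

definition L_op :: "('u \<Rightarrow> 'u \<Rightarrow> 'u \<Rightarrow> 'u) \<Rightarrow> 'u \<Rightarrow> 'u \<Rightarrow> 'u" where
  "L_op t e x = t e e x"

definition R_op :: "('u \<Rightarrow> 'u \<Rightarrow> 'u \<Rightarrow> 'u) \<Rightarrow> 'u \<Rightarrow> 'u \<Rightarrow> 'u" where
  "R_op t e x = t x e e"

definition Q_op :: "('u \<Rightarrow> 'u \<Rightarrow> 'u \<Rightarrow> 'u) \<Rightarrow> 'u \<Rightarrow> 'u \<Rightarrow> 'u" where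
  "Q_op t e x = t e x e"

definition peirce_space ::
    "('k \<Rightarrow> 'u \<Rightarrow> 'u) \<Rightarrow> ('u \<Rightarrow> 'u \<Rightarrow> 'u \<Rightarrow> 'u) \<Rightarrow> 'u \<Rightarrow> 'k \<Rightarrow> 'k \<Rightarrow> 'u set" where
  "peirce_space scale t e l m = {a. L_op t e a = scale l a \<and> R_op t e a = scale m a}"

text \<open>The subspaces \<open>U\<^sub>1\<^sub>1\<^sup>\<plusminus>\<close> and \<open>U\<^sub>1\<^sub>3\<^sup>\<plusminus>\<close> arise for \<open>(l, m, q) = (1, 1, \<plusminus>1)\<close> and
  \<open>(l, m, q) = (1, 3, \<plusminus>3)\<close>.\<close>
definition peirce_space_Q ::
    "('k \<Rightarrow> 'u \<Rightarrow> 'u) \<Rightarrow> ('u \<Rightarrow> 'u \<Rightarrow> 'u \<Rightarrow> 'u) \<Rightarrow> 'u \<Rightarrow> 'k \<Rightarrow> 'k \<Rightarrow> 'k \<Rightarrow> 'u set" where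
  "peirce_space_Q scale t e l m q = {a \<in> peirce_space scale t e l m. Q_op t e a = scale q a}"

text \<open>Internal direct sum decomposition of the whole space. The summands form a list rather than
  a set, so that several of them may coincide (as zero subspaces) and are still counted
  separately.\<close>
definition is_direct_sum :: "('k::field \<Rightarrow> 'u::ab_group_add \<Rightarrow> 'u) \<Rightarrow> 'u set list \<Rightarrow> bool" where
  "is_direct_sum scale Vs \<longleftrightarrow>
     (\<forall>V \<in> set Vs. module.subspace scale V) \<and>
     (\<forall>x. \<exists>!xs. list_all2 (\<in>) xs Vs \<and> sum_list xs = x)"

end

theory Submission
  imports Defs
begin

text \<open>Specialising the two identities to \<open>e\<close> gives
  \<open>(R - L) (R - 2 L - 1) = 0\<close>, \<open>L Q + Q L = 2 Q\<close>, \<open>R Q - Q R = Q - L Q\<close> and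
  \<open>Q\<^sup>2 = R (R + L - 1)\<close>. Hence \<open>Q (R + 2 L - 3) (R + 3 L - 6) = 0\<close>, so \<open>F 0 F 1 F 2 F 3 = 0\<close>
  where \<open>F k = R + k L - k (k + 1) / 2\<close>. The two curves \<open>R = L\<close> and \<open>R = 2 L + 1\<close> meet only at
  \<open>L = R = -1\<close>, where this product is \<open>1 \<cdot> 3 \<cdot> 6 \<cdot> 10 \<noteq> 0\<close>; therefore \<open>U\<close> is the sum of the kernels of
  \<open>R - L\<close> and \<open>R - 2 L - 1\<close>, and on each of them the product splits into four distinct linear factors
  in \<open>L\<close>. This yields eight joint eigenspaces of \<open>L\<close> and \<open>R\<close>, two of which \<open>Q\<close> splits further.
  Linearising weak commutativity at \<open>e\<close> gives \<open>(R - L) (R + Q + L - 1) = 0\<close>, which annihilates four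
  of the ten summands.\<close>

section \<open>Linear algebra: joint eigenvectors and direct sums over lists\<close>

text \<open>Induction on the index set: for a new index \<open>(l, m)\<close>, applying
  \<open>f - l\<close> and \<open>g - m\<close> to the relation kills its term and rescales the
  others. Every other index differs from \<open>(l, m)\<close> in some coordinate, so one of its two
  scalars is non-zero.\<close>

lemma (in vector_space) joint_eigenvectors_independent:
  assumes f: "Vector_Spaces.linear scale scale f" and g: "Vector_Spaces.linear scale scale g"
    and "finite I"
    and "\<And>l m. (l, m) \<in> I \<Longrightarrow> f (v (l, m)) = scale l (v (l, m)) \<and> g (v (l, m)) = scale m (v (l, m))"
    and "(\<Sum>p\<in>I. v p) = 0"
    and "p \<in> I"
  shows "v p = 0"
proof -
  interpret f: Vector_Spaces.linear scale scale f by (fact f)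
  interpret g: Vector_Spaces.linear scale scale g by (fact g)
  have "\<forall>p\<in>I. v p = 0"
    using assms(3-5)
  proof (induction I arbitrary: v rule: finite_induct)
    case empty
    then show ?case by simp
  next
    case (insert q I)
    obtain l m where q: "q = (l, m)" by force
    have v_q: "v q = - (\<Sum>p\<in>I. v p)"
      using insert.hyps insert.prems(2) by (simp add: eq_neg_iff_add_eq_0)
    have eig: "f (v p) = scale (fst p) (v p)" "g (v p) = scale (snd p) (v p)" if "p \<in> insert q I" for p
      using insert.prems(1)[of "fst p" "snd p"] that by auto
    have "(\<Sum>p\<in>I. scale (fst p - l) (v p)) = f (\<Sum>p\<in>insert q I. v p) - scale l (\<Sum>p\<in>insert q I. v p)"
      using insert.hyps eig q
      by (simp add: f.add f.sum scale_right_distrib scale_sum_right scale_left_diff_distrib sum_subtractf)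
    then have sum_f: "(\<Sum>p\<in>I. scale (fst p - l) (v p)) = 0"
      using insert.prems(2) by simp
    have "(\<Sum>p\<in>I. scale (snd p - m) (v p)) = g (\<Sum>p\<in>insert q I. v p) - scale m (\<Sum>p\<in>insert q I. v p)"
      using insert.hyps eig q
      by (simp add: g.add g.sum scale_right_distrib scale_sum_right scale_left_diff_distrib sum_subtractf)
    then have sum_g: "(\<Sum>p\<in>I. scale (snd p - m) (v p)) = 0"
      using insert.prems(2) by simp
    have eig': "f (scale c (v (l', m'))) = scale l' (scale c (v (l', m'))) \<and>
        g (scale c (v (l', m'))) = scale m' (scale c (v (l', m')))" if "(l', m') \<in> I" for l' m' c
      using eig[of "(l', m')"] that by (simp add: f.scale g.scale mult.commute)
    have "v p = 0" if "p \<in> I" for p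
    proof -
      have "scale (fst p - l) (v p) = 0"
        using insert.IH[of "\<lambda>p. scale (fst p - l) (v p)"] eig' sum_f that by auto
      moreover have "scale (snd p - m) (v p) = 0"
        using insert.IH[of "\<lambda>p. scale (snd p - m) (v p)"] eig' sum_g that by auto
      moreover have "p \<noteq> (l, m)"
        using insert.hyps q that by auto
      ultimately show ?thesis
        by (auto simp: prod_eq_iff)
    qed
    then show ?case
      using v_q by simp
  qed
  then show ?thesis
    using \<open>p \<in> I\<close> by blast
qed

text \<open>As \<open>f\<close> rescales each element of \<open>B\<close> by a non-zero scalar,
  \<open>span B\<close> lies in its own image. So \<open>f x = f y\<close> with \<open>y\<close> in
  \<open>span B\<close>, and \<open>x - y\<close> is in the kernel. This peels one factor off an
  annihilating product of operators, adding \<open>C\<close> to the span.\<close>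

lemma (in vector_space) mem_span_eigenvectors:
  assumes f: "Vector_Spaces.linear scale scale f"
    and K: "subspace K" "B \<subseteq> K"
    and B: "\<And>v. v \<in> B \<Longrightarrow> \<exists>c. c \<noteq> 0 \<and> f v = scale c v"
    and x: "x \<in> K" "f x \<in> span B"
    and C: "\<And>y. y \<in> K \<Longrightarrow> f y = 0 \<Longrightarrow> y \<in> C"
  shows "x \<in> span (B \<union> C)"
proof -
  interpret f: Vector_Spaces.linear scale scale f by (fact f)
  have "B \<subseteq> f ` span B"
  proof
    fix v assume v: "v \<in> B"
    then obtain c where c: "c \<noteq> 0" "f v = scale c v" using B by blast
    then have "v = f (scale (1 / c) v)" by (simp add: f.scale)
    then show "v \<in> f ` span B" using v by (metis imageI span_base span_scale)
  qed
  then have "span B \<subseteq> f ` span B"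
    by (intro span_minimal f.subspace_image subspace_span)
  then obtain y where y: "y \<in> span B" "f x = f y" using x by blast
  have "y \<in> K" using y(1) span_minimal[OF K(2,1)] by blast
  then have "x - y \<in> C" using C x(1) K(1) y(2) by (simp add: subspace_diff f.diff)
  then have "y + (x - y) \<in> span (B \<union> C)"
    using y(1) span_mono[of B "B \<union> C"] by (intro span_add) (auto intro: span_base)
  then show ?thesis by simp
qed

lemma (in vector_space) span_Union_list:
  assumes "\<forall>V\<in>set Vs. subspace V" "x \<in> span (\<Union>(set Vs))"
  shows "\<exists>xs. list_all2 (\<in>) xs Vs \<and> sum_list xs = x"
  using assms
proof (induction Vs arbitrary: x)
  case Nil
  then show ?case by simp
next
  case (Cons V Vs)
  then have "x \<in> span (V \<union> \<Union>(set Vs))" by simp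
  then obtain a b where "x = a + b" "a \<in> span V" "b \<in> span (\<Union>(set Vs))"
    unfolding span_Un by blast
  then have ab: "x = a + b" "a \<in> V" "b \<in> span (\<Union>(set Vs))"
    using Cons.prems(1) by (simp_all add: span_eq_iff[THEN iffD2])
  with Cons.IH[of b] Cons.prems(1) obtain xs where "list_all2 (\<in>) xs Vs" "sum_list xs = b"
    by auto
  with ab show ?case by (intro exI[of _ "a # xs"]) simp
qed

text \<open>Reduces uniqueness to the zero vector: two decompositions of one vector differ by a
  decomposition of 0.\<close>

lemma (in vector_space) list_all2_mem_diff:
  assumes "\<forall>V\<in>set Vs. subspace V" "list_all2 (\<in>) xs Vs" "list_all2 (\<in>) ys Vs"
  shows "list_all2 (\<in>) (map2 (-) xs ys) Vs \<and> sum_list (map2 (-) xs ys) = sum_list xs - sum_list ys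
    \<and> ((\<forall>z\<in>set (map2 (-) xs ys). z = 0) \<longrightarrow> xs = ys)"
  using assms
proof (induction Vs arbitrary: xs ys)
  case Nil
  then show ?case by simp
next
  case (Cons V Vs)
  then obtain x xs' y ys' where "xs = x # xs'" "ys = y # ys'" "x \<in> V" "y \<in> V"
    "list_all2 (\<in>) xs' Vs" "list_all2 (\<in>) ys' Vs"
    by (auto simp: list_all2_Cons2)
  then show ?case
    using Cons.IH[of xs' ys'] Cons.prems(1) by (auto simp: subspace_diff)
qed

lemma (in vector_space) is_direct_sumI:
  assumes subspaces: "\<forall>V\<in>set Vs. subspace V"
    and spanning: "\<And>x. x \<in> span (\<Union>(set Vs))"
    and independent: "\<And>xs. list_all2 (\<in>) xs Vs \<Longrightarrow> sum_list xs = 0 \<Longrightarrow> \<forall>x\<in>set xs. x = 0"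
  shows "is_direct_sum scale Vs"
  unfolding is_direct_sum_def
proof (intro conjI allI)
  fix x
  obtain xs where xs: "list_all2 (\<in>) xs Vs" "sum_list xs = x"
    using span_Union_list[OF subspaces spanning] by blast
  show "\<exists>!xs. list_all2 (\<in>) xs Vs \<and> sum_list xs = x"
  proof (rule ex1I[of _ xs])
    fix ys assume "list_all2 (\<in>) ys Vs \<and> sum_list ys = x"
    then show "ys = xs"
      using list_all2_mem_diff[OF subspaces, of ys xs] independent[of "map2 (-) ys xs"] xs by auto
  qed (use xs in simp)
qed (use subspaces in blast)

text \<open>Deleting or inserting a 0 at position \<open>length Vs\<close> passes between
  decompositions over the two lists without changing the sum, so existence and uniqueness both
  transfer.\<close>

lemma is_direct_sum_remove_zero:
  assumes "is_direct_sum scale (Vs @ {0} # Ws)"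
  shows "is_direct_sum scale (Vs @ Ws)"
  unfolding is_direct_sum_def
proof (intro conjI allI)
  show "\<forall>V\<in>set (Vs @ Ws). module.subspace scale V"
    using assms by (auto simp: is_direct_sum_def)
  have split: "list_all2 (\<in>) (take (length Vs) xs @ 0 # drop (length Vs) xs) (Vs @ {0} # Ws)
      \<and> sum_list (take (length Vs) xs @ 0 # drop (length Vs) xs) = sum_list xs"
    if "list_all2 (\<in>) xs (Vs @ Ws)" for xs
  proof -
    obtain us vs where "xs = us @ vs" "length us = length Vs" "list_all2 (\<in>) us Vs" "list_all2 (\<in>) vs Ws"
      using \<open>list_all2 (\<in>) xs (Vs @ Ws)\<close> unfolding list_all2_append2 by blast
    then show ?thesis by (simp add: list_all2_appendI)
  qed
  fix x
  from assms have ex1: "\<exists>!xs. list_all2 (\<in>) xs (Vs @ {0} # Ws) \<and> sum_list xs = x"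
    by (simp add: is_direct_sum_def)
  then obtain xs where "list_all2 (\<in>) xs (Vs @ {0} # Ws)" "sum_list xs = x" by blast
  then obtain us vs where "list_all2 (\<in>) us Vs" "list_all2 (\<in>) vs Ws" "sum_list us + sum_list vs = x"
    unfolding list_all2_append2 list_all2_Cons2 by fastforce
  then have ex: "list_all2 (\<in>) (us @ vs) (Vs @ Ws) \<and> sum_list (us @ vs) = x"
    by (simp add: list_all2_appendI)
  have "ys = zs" if "list_all2 (\<in>) ys (Vs @ Ws) \<and> sum_list ys = x"
    "list_all2 (\<in>) zs (Vs @ Ws) \<and> sum_list zs = x" for ys zs
  proof -
    have "take (length Vs) ys @ 0 # drop (length Vs) ys = take (length Vs) zs @ 0 # drop (length Vs) zs"
    proof (rule ex1E[OF ex1])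
      fix ws assume unique: "\<forall>us. list_all2 (\<in>) us (Vs @ {0} # Ws) \<and> sum_list us = x \<longrightarrow> us = ws"
      have "take (length Vs) ys @ 0 # drop (length Vs) ys = ws"
        by (rule unique[rule_format]) (use split[of ys] that in simp)
      moreover have "take (length Vs) zs @ 0 # drop (length Vs) zs = ws"
        by (rule unique[rule_format]) (use split[of zs] that in simp)
      ultimately show ?thesis by simp
    qed
    moreover have "length ys = length zs"
      using that by (auto dest!: list_all2_lengthD)
    ultimately have "take (length Vs) ys = take (length Vs) zs \<and> drop (length Vs) ys = drop (length Vs) zs"
      by simp
    then show ?thesis
      by (metis append_take_drop_id)
  qed
  with ex show "\<exists>!xs. list_all2 (\<in>) xs (Vs @ Ws) \<and> sum_list xs = x"
    by (intro ex_ex1I exI[of _ "us @ vs"])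
qed

section \<open>Operator identities for \<open>L\<close>, \<open>R\<close> and
  \<open>Q\<close>\<close>

locale peirce = gen_jordan_triple_2 scale t
  for scale :: "'k::field \<Rightarrow> 'u::ab_group_add \<Rightarrow> 'u" and t +
  fixes e :: 'u
  assumes eee: "t e e e = e"
    and two_nz: "(2 :: 'k) \<noteq> 0" and three_nz: "(3 :: 'k) \<noteq> 0" and five_nz: "(5 :: 'k) \<noteq> 0"
begin

sublocale t1: Vector_Spaces.linear scale scale "\<lambda>x. t x y z" for y z by (fact linear_1)
sublocale t2: Vector_Spaces.linear scale scale "\<lambda>y. t x y z" for x z by (fact linear_2)
sublocale t3: Vector_Spaces.linear scale scale "\<lambda>z. t x y z" for x y by (fact linear_3)

abbreviation L where "L \<equiv> L_op t e"
abbreviation R where "R \<equiv> R_op t e"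
abbreviation Q where "Q \<equiv> Q_op t e"
abbreviation U where "U \<equiv> peirce_space scale t e"
abbreviation UQ where "UQ \<equiv> peirce_space_Q scale t e"

sublocale L: Vector_Spaces.linear scale scale L
  using linear_3 by (simp add: L_op_def[abs_def])
sublocale R: Vector_Spaces.linear scale scale R
  using linear_1 by (simp add: R_op_def[abs_def])
sublocale Q: Vector_Spaces.linear scale scale Q
  using linear_2 by (simp add: Q_op_def[abs_def])

lemmas lin_simps = L.add L.diff L.neg L.scale R.add R.diff R.neg R.scale Q.add Q.diff Q.neg Q.scale

text \<open>Only the primes 2, 3 and 5 divide these numerals; this is how the characteristic enters
  later computations.\<close>

lemma nonzero_numerals [simp]:
  "(2 :: 'k) \<noteq> 0" "(3 :: 'k) \<noteq> 0" "(4 :: 'k) \<noteq> 0" "(5 :: 'k) \<noteq> 0" "(6 :: 'k) \<noteq> 0"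
  "(8 :: 'k) \<noteq> 0" "(9 :: 'k) \<noteq> 0" "(10 :: 'k) \<noteq> 0" "(12 :: 'k) \<noteq> 0" "(15 :: 'k) \<noteq> 0" "(20 :: 'k) \<noteq> 0"
proof -
  have "(4 :: 'k) = 2 * 2" "(6 :: 'k) = 2 * 3" "(8 :: 'k) = 2 * 2 * 2" "(9 :: 'k) = 3 * 3"
    "(10 :: 'k) = 2 * 5" "(12 :: 'k) = 2 * 2 * 3" "(15 :: 'k) = 3 * 5" "(20 :: 'k) = 2 * 2 * 5"
    by simp_all
  then show "(4 :: 'k) \<noteq> 0" "(6 :: 'k) \<noteq> 0" "(8 :: 'k) \<noteq> 0" "(9 :: 'k) \<noteq> 0" "(10 :: 'k) \<noteq> 0"
    "(12 :: 'k) \<noteq> 0" "(15 :: 'k) \<noteq> 0" "(20 :: 'k) \<noteq> 0"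
    using two_nz three_nz five_nz by (metis mult_eq_0_iff)+
qed (fact two_nz three_nz five_nz)+

declare nonzero_numerals [symmetric, simp]

lemma distinct_numerals [simp]:
  "(1 :: 'k) \<noteq> 2" "(1 :: 'k) \<noteq> 3" "(2 :: 'k) \<noteq> 3" "(2 :: 'k) \<noteq> 1" "(3 :: 'k) \<noteq> 1" "(3 :: 'k) \<noteq> 2"
proof -
  have "(2 :: 'k) - 1 = 1" "(3 :: 'k) - 1 = 2" "(3 :: 'k) - 2 = 1" by simp_all
  then show "(1 :: 'k) \<noteq> 2" "(1 :: 'k) \<noteq> 3" "(2 :: 'k) \<noteq> 3" "(2 :: 'k) \<noteq> 1" "(3 :: 'k) \<noteq> 1" "(3 :: 'k) \<noteq> 2"
    by (metis nonzero_numerals(1) one_neq_zero diff_self)+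
qed

lemma half_numerals [simp]: "(6 :: 'k) / 2 = 3" "(12 :: 'k) / 2 = 6"
  by (simp_all add: divide_eq_eq)

lemma scale_numerals:
  "scale 2 x = x + x" "scale 3 x = x + x + x" "scale 6 x = x + x + x + x + x + x"
proof -
  have "scale 2 x = scale (1 + 1) x" "scale 3 x = scale (1 + 1 + 1) x"
    "scale 6 x = scale (1 + 1 + 1 + 1 + 1 + 1) x" by simp_all
  then show "scale 2 x = x + x" "scale 3 x = x + x + x" "scale 6 x = x + x + x + x + x + x"
    by (simp_all only: scale_left_distrib scale_one)
qed

text \<open>This and the next three relations put \<open>x\<close> into one slot of the derivation
  identity, in turn \<open>c\<close>, \<open>d\<close>, \<open>b\<close>, \<open>a\<close>, and
  \<open>e\<close> into the other four.\<close>

lemma R_L: "R (L x) = L (R x)"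
  using derivation_identity[of e e x e e] by (simp add: L_op_def R_op_def eee)

lemma L_Q: "L (Q x) = Q x + Q x - Q (L x)"
  using derivation_identity[of e e e x e] by (simp add: L_op_def Q_op_def eee)

lemma R_Q: "R (Q x) = Q (R x) + Q x - L (Q x)"
  using derivation_identity[of e x e e e] by (simp add: L_op_def R_op_def Q_op_def eee algebra_simps)

lemma Q_Q: "Q (Q x) = R (R x) + L (R x) - R x"
  using derivation_identity[of x e e e e] by (simp add: L_op_def R_op_def Q_op_def eee algebra_simps)

text \<open>Alternating in \<open>x\<close> and \<open>e\<close>, with \<open>e\<close> elsewhere,
  gives \<open>R R - 2 L R - R - (R L - 2 L L - L)\<close>; since \<open>L\<close> and
  \<open>R\<close> commute, it factors as \<open>(R - L) (R - 2 L - 1)\<close>.\<close>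

lemma second_order: "R (R x - scale 2 (L x) - x) = L (R x - scale 2 (L x) - x)"
proof -
  have "R (R x) - L (R x) - L (R x) - R x - (R (L x) - L (L x) - L (L x) - L x) = 0"
    using second_order_identity[of e e e x e] by (simp only: L_op_def R_op_def eee alternation_def)
  moreover have "R (R x - scale 2 (L x) - x) - L (R x - scale 2 (L x) - x)
      = R (R x) - L (R x) - L (R x) - R x - (R (L x) - L (L x) - L (L x) - L x)"
    by (simp add: lin_simps R_L scale_numerals algebra_simps)
  ultimately show ?thesis by simp
qed

text \<open>With \<open>A = R - L\<close> and \<open>B = R - 2 L - 1\<close> one has
  \<open>Q\<^sup>2 = F 0 \<circ> F 1\<close>, \<open>A Q = Q \<circ> F 2\<close> and \<open>B Q = Q \<circ> F 3\<close>.\<close>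
definition F where "F k x = R x + scale k (L x) - scale (k * (k + 1) / 2) x"

sublocale F: Vector_Spaces.linear scale scale "F k" for k
  by unfold_locales (simp_all add: F_def lin_simps scale_right_distrib scale_right_diff_distrib mult.commute algebra_simps)

text \<open>By \<open>second_order\<close>, \<open>A B Q = 0\<close>. Moving \<open>B\<close> and
  then \<open>A\<close> past \<open>Q\<close> turns this into \<open>Q (F 2 (F 3 x)) = 0\<close>,
  and one more \<open>Q\<close> in front produces \<open>F 0\<close> and \<open>F 1\<close>.\<close>

lemma F_product: "F 0 (F 1 (F 2 (F 3 x))) = 0"
proof -
  have QQ: "F 0 (F 1 y) = Q (Q y)" for y
    by (simp add: F_def lin_simps Q_Q R_L)
  have AQ: "R (Q y) - L (Q y) = Q (F 2 y)" for y
    by (simp add: F_def lin_simps R_Q L_Q scale_numerals algebra_simps)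
  have BQ: "R (Q y) - scale 2 (L (Q y)) - Q y = Q (F 3 y)" for y
    by (simp add: F_def lin_simps R_Q L_Q scale_numerals algebra_simps)
  have "Q (F 2 (F 3 x)) = 0"
    using AQ[of "F 3 x"] BQ[of x] second_order[of "Q x"] by simp
  then show ?thesis by (simp add: QQ)
qed

lemma subspace_U: "subspace (U l m)"
  by (rule subspaceI) (auto simp: peirce_space_def lin_simps scale_right_distrib mult.commute)

lemma subspace_UQ: "subspace (UQ l m q)"
  unfolding peirce_space_Q_def
  by (rule subspaceI) (auto simp: peirce_space_def lin_simps scale_right_distrib mult.commute)

lemma F_U: "x \<in> U l m \<Longrightarrow> F k x = scale (m + k * l - k * (k + 1) / 2) x"
  by (simp add: F_def peirce_space_def scale_left_distrib scale_left_diff_distrib)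

text \<open>On \<open>U l m\<close> the relation \<open>second_order\<close> becomes multiplication
  by \<open>(m - l) (m - 2 l - 1)\<close>.\<close>

lemma U_eq_0:
  assumes "x \<in> U l m" "m \<noteq> l" "m \<noteq> 2 * l + 1"
  shows "x = 0"
proof -
  have "R x - scale 2 (L x) - x = scale (m - 2 * l - 1) x"
    using assms(1) by (simp add: peirce_space_def scale_left_diff_distrib)
  then have "R (scale (m - 2 * l - 1) x) = L (scale (m - 2 * l - 1) x)"
    using second_order[of x] by metis
  then have "scale ((m - 2 * l - 1) * m) x = scale ((m - 2 * l - 1) * l) x"
    using assms(1) by (simp only: lin_simps peirce_space_def mem_Collect_eq scale_scale)
  then have "m = l \<or> m - 2 * l - 1 = 0 \<or> x = 0"
    by (simp only: scale_cancel_right mult_cancel_left) blast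
  moreover have "m - 2 * l - 1 = m - (2 * l + 1)" by simp
  ultimately show ?thesis using assms(2,3) by (metis right_minus_eq)
qed

text \<open>The commutation rules read \<open>L Q = Q (2 - L)\<close> and
  \<open>R Q = Q (R + L - 1)\<close>.\<close>

lemma Q_U: "x \<in> U l m \<Longrightarrow> Q x \<in> U (2 - l) (m + l - 1)"
  by (simp add: peirce_space_def lin_simps R_Q L_Q scale_left_distrib scale_left_diff_distrib scale_numerals algebra_simps)

lemma Q_Q_U: "x \<in> U l m \<Longrightarrow> Q (Q x) = scale (m * (m + l - 1)) x"
  by (simp add: peirce_space_def lin_simps Q_Q scale_left_distrib scale_left_diff_distrib right_diff_distrib ring_distribs algebra_simps)

section \<open>Spanning by the eight joint eigenspaces of \<open>L\<close> and
  \<open>R\<close>\<close>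

definition peirce_sum where
  "peirce_sum = span (U 0 0 \<union> U (1/2) (1/2) \<union> U 1 1 \<union> U (3/2) (3/2)
     \<union> U (-1/2) 0 \<union> U 0 1 \<union> U (1/2) 2 \<union> U 1 3)"

lemma subspace_peirce_sum: "subspace peirce_sum"
  by (simp add: peirce_sum_def)

text \<open>Where \<open>R = L\<close>, the operator \<open>F k\<close> equals
  \<open>(k + 1) (L - k/2)\<close>.\<close>

lemma U_kernel_R_minus_L:
  assumes "R x = L x" "F k x = 0" "k \<noteq> -1"
  shows "x \<in> U (k/2) (k/2)"
proof -
  have "scale (k + 1) (L x) = scale ((k + 1) * (k/2)) x"
    using assms(1,2) by (simp add: F_def scale_left_distrib algebra_simps)
  then have "L x = scale (k/2) x"
    using assms(3) by (metis add_eq_0_iff2 scale_scale scale_left_imp_eq)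
  then show ?thesis using assms(1) by (simp add: peirce_space_def)
qed

text \<open>Where \<open>R = 2 L + 1\<close>, the operator \<open>F k\<close> equals
  \<open>(k + 2) (L - (k-1)/2)\<close>.\<close>

lemma U_kernel_R_minus_2L_minus_1:
  assumes "R x = scale 2 (L x) + x" "F k x = 0" "k \<noteq> -2"
  shows "x \<in> U ((k-1)/2) k"
proof -
  have k: "k * (k + 1) / 2 - 1 = (k + 2) * ((k-1)/2)" by (simp add: field_simps)
  have "scale (k + 2) (L x) = scale (k * (k + 1) / 2 - 1) x"
    using assms(1,2) by (simp add: F_def scale_left_distrib scale_left_diff_distrib algebra_simps)
  then have L: "L x = scale ((k-1)/2) x"
    using assms(3) unfolding k by (metis add_eq_0_iff2 scale_scale scale_left_imp_eq)
  have "2 * ((k-1)/2) + 1 = k" by (simp only: nonzero_mult_div_cancel_left times_divide_eq_right two_nz not_False_eq_True) simp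
  moreover have "R x = scale (2 * ((k-1)/2) + 1) x"
    unfolding assms(1) L by (simp only: scale_left_distrib scale_scale scale_one)
  ultimately show ?thesis using L by (simp add: peirce_space_def)
qed

text \<open>The factors \<open>F 0\<close>, ..., \<open>F 3\<close> of \<open>F_product\<close> are
  peeled off from the outside, each contributing one eigenspace inside the invariant subspace
  \<open>K\<close>.\<close>

lemma kernel_R_minus_L_subset:
  assumes "R x = L x"
  shows "x \<in> peirce_sum"
proof -
  define K where "K = {x. R x = L x}"
  have K: "subspace K" by (rule subspaceI) (auto simp: K_def lin_simps)
  have F_K: "F k y \<in> K" if "y \<in> K" for k y
    using that by (simp add: K_def F_def lin_simps R_L)
  \<comment> \<open>On the earlier eigenspaces \<open>F k\<close> acts as
    \<open>(k + 1) (j - k) / 2\<close>, which is non-zero under the two side conditions.\<close>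
  have step: "y \<in> span ((\<Union>j\<in>J. U (j/2) (j/2)) \<union> U (k/2) (k/2))"
    if y: "y \<in> K" "F k y \<in> span (\<Union>j\<in>J. U (j/2) (j/2))" and k: "k + 1 \<noteq> 0" "\<forall>j\<in>J. j - k \<noteq> 0" for J k y
  proof (rule mem_span_eigenvectors[OF F.linear_axioms K _ _ y])
    fix v assume "v \<in> (\<Union>j\<in>J. U (j/2) (j/2))"
    then obtain j where j: "j \<in> J" "v \<in> U (j/2) (j/2)" by blast
    have "F k v = scale ((k + 1) * (j - k) / 2) v"
      unfolding F_U[OF j(2)] by (simp add: field_simps)
    with j(1) k show "\<exists>c. c \<noteq> 0 \<and> F k v = scale c v"
      by (intro exI[of _ "(k + 1) * (j - k) / 2"]) simp
  next
    fix y assume "y \<in> K" "F k y = 0"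
    then show "y \<in> U (k/2) (k/2)"
      using k(1) by (intro U_kernel_R_minus_L) (auto simp: K_def)
  qed (auto simp: K_def peirce_space_def)
  have 0: "x \<in> K" using assms by (simp add: K_def)
  \<comment> \<open>The start is \<open>J = {}\<close>: membership in the zero span is
    \<open>F_product\<close>.\<close>
  have 1: "F 1 (F 2 (F 3 x)) \<in> span (\<Union>j\<in>{0}. U (j/2) (j/2))"
    using step[of "F 1 (F 2 (F 3 x))" 0 "{}"] F_product 0 by (simp add: F_K span_zero)
  have 2: "F 2 (F 3 x) \<in> span (\<Union>j\<in>{0, 1}. U (j/2) (j/2))"
    using step[OF _ 1] 0 by (simp add: F_K Un_commute)
  have 3: "F 3 x \<in> span (\<Union>j\<in>{0, 1, 2}. U (j/2) (j/2))"
    using step[OF _ 2] 0 by (simp add: F_K Un_ac)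
  have "x \<in> span ((\<Union>j\<in>{0, 1, 2}. U (j/2) (j/2)) \<union> U (3/2) (3/2))"
    using step[OF 0 3] by simp
  then show ?thesis
    unfolding peirce_sum_def by (rule rev_subsetD[OF _ span_mono]) auto
qed

text \<open>The same peeling on the other line, with eigenspaces indexed by the eigenvalue
  \<open>k\<close> of \<open>R\<close>.\<close>

lemma kernel_R_minus_2L_minus_1_subset:
  assumes "R x = scale 2 (L x) + x"
  shows "x \<in> peirce_sum"
proof -
  define K where "K = {x. R x = scale 2 (L x) + x}"
  have K: "subspace K" by (rule subspaceI) (auto simp: K_def lin_simps scale_right_distrib mult.commute)
  have F_K: "F k y \<in> K" if "y \<in> K" for k y
    using that by (simp add: K_def F_def lin_simps R_L scale_right_distrib scale_right_diff_distrib mult.commute algebra_simps)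
  \<comment> \<open>The eigenvalue of \<open>F k\<close> is now \<open>(k + 2) (j - k) / 2\<close>;
    for \<open>k = 3\<close> its first factor is 5.\<close>
  have step: "y \<in> span ((\<Union>j\<in>J. U ((j-1)/2) j) \<union> U ((k-1)/2) k)"
    if y: "y \<in> K" "F k y \<in> span (\<Union>j\<in>J. U ((j-1)/2) j)" and k: "k + 2 \<noteq> 0" "\<forall>j\<in>J. j - k \<noteq> 0" for J k y
  proof (rule mem_span_eigenvectors[OF F.linear_axioms K _ _ y])
    fix v assume "v \<in> (\<Union>j\<in>J. U ((j-1)/2) j)"
    then obtain j where j: "j \<in> J" "v \<in> U ((j-1)/2) j" by blast
    have "F k v = scale ((k + 2) * (j - k) / 2) v"
      unfolding F_U[OF j(2)] by (simp add: field_simps)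
    with j(1) k show "\<exists>c. c \<noteq> 0 \<and> F k v = scale c v"
      by (intro exI[of _ "(k + 2) * (j - k) / 2"]) simp
  next
    fix y assume "y \<in> K" "F k y = 0"
    then show "y \<in> U ((k-1)/2) k"
      using k(1) by (intro U_kernel_R_minus_2L_minus_1) (auto simp: K_def)
  next
    show "(\<Union>j\<in>J. U ((j-1)/2) j) \<subseteq> K"
    proof (clarsimp simp: K_def peirce_space_def)
      fix j y
      have "scale (2 * (j - 1) / 2) y = scale (j - 1) y" by (simp only: nonzero_mult_div_cancel_left two_nz not_False_eq_True)
      then show "scale j y = scale ((2 * j - 2) / 2) y + y"
        by (simp add: scale_left_diff_distrib right_diff_distrib)
    qed
  qed
  have 0: "x \<in> K" using assms by (simp add: K_def)
  have 1: "F 1 (F 2 (F 3 x)) \<in> span (\<Union>j\<in>{0}. U ((j-1)/2) j)"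
    using step[of "F 1 (F 2 (F 3 x))" 0 "{}"] F_product 0 by (simp add: F_K span_zero)
  have 2: "F 2 (F 3 x) \<in> span (\<Union>j\<in>{0, 1}. U ((j-1)/2) j)"
    using step[OF _ 1] 0 by (simp add: F_K Un_commute)
  have 3: "F 3 x \<in> span (\<Union>j\<in>{0, 1, 2}. U ((j-1)/2) j)"
    using step[OF _ 2] 0 by (simp add: F_K Un_ac)
  have "x \<in> span ((\<Union>j\<in>{0, 1, 2}. U ((j-1)/2) j) \<union> U ((3-1)/2) 3)"
    using step[OF 0 3] by simp
  then show ?thesis
    unfolding peirce_sum_def by (rule rev_subsetD[OF _ span_mono]) auto
qed

text \<open>The images of \<open>R - L\<close> and \<open>R - 2 L - 1\<close> lie in each other's
  kernels, hence in \<open>peirce_sum\<close>. So \<open>L = R = -1\<close> modulo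
  \<open>peirce_sum\<close>, and every \<open>F k\<close> acts there as a scalar.\<close>

lemma mem_peirce_sum: "x \<in> peirce_sum"
proof -
  have A: "R y - L y \<in> peirce_sum" for y
    using second_order[of y] by (intro kernel_R_minus_2L_minus_1_subset) (simp add: lin_simps R_L algebra_simps)
  have B: "R y - scale 2 (L y) - y \<in> peirce_sum" for y
    using second_order by (rule kernel_R_minus_L_subset)
  note closed = subspace_add[OF subspace_peirce_sum] subspace_diff[OF subspace_peirce_sum]
    subspace_scale[OF subspace_peirce_sum]
  have L: "L y + y \<in> peirce_sum" for y
    using closed(2)[OF A[of y] B[of y]] by (simp add: scale_numerals algebra_simps)
  have R: "R y + y \<in> peirce_sum" for y
    using closed(1)[OF A[of y] L[of y]] by simp
  \<comment> \<open>Modulo \<open>peirce_sum\<close>, \<open>F k\<close> is the scalar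
    \<open>- (k + 1) (k + 2) / 2\<close>, so it can be cancelled.\<close>
  have descend: "y \<in> peirce_sum" if F_y: "F k y \<in> peirce_sum" and "(k + 1) * (k + 2) / 2 \<noteq> 0" for k y
  proof -
    define c where "c = (k + 1) * (k + 2) / 2"
    have "c = 1 + k + k * (k + 1) / 2" by (simp add: c_def field_simps)
    then have "scale c y = (R y + y) + scale k (L y + y) - F k y"
      by (simp only: F_def scale_left_distrib scale_right_distrib scale_one) simp
    then have "scale c y \<in> peirce_sum"
      using closed(2)[OF closed(1)[OF R closed(3)[OF L]] F_y] by (simp only:)
    then have "scale (inverse c) (scale c y) \<in> peirce_sum" by (rule closed(3))
    moreover have "c \<noteq> 0" using that(2) unfolding c_def .
    ultimately show ?thesis by simp
  qed
  have "F 0 (F 1 (F 2 (F 3 x))) \<in> peirce_sum"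
    using subspace_0[OF subspace_peirce_sum] F_product by simp
  from this[THEN descend, THEN descend, THEN descend, THEN descend] show ?thesis by simp
qed

section \<open>The action of \<open>Q\<close> on the eigenspaces\<close>

text \<open>The numbers \<open>c\<close> and \<open>d\<close> measure how far the indices of
  \<open>Q x\<close> from \<open>Q_U\<close> are from the lines \<open>m = l\<close> and
  \<open>m = 2 l + 1\<close>; off both lines \<open>U_eq_0\<close> applies.\<close>

lemma Q_eq_0_if:
  assumes "x \<in> U l m" "m + 2 * l - 3 = c" "c \<noteq> 0" "m + 3 * l - 6 = d" "d \<noteq> 0"
  shows "Q x = 0"
proof (rule U_eq_0[OF Q_U[OF assms(1)]])
  have "(m + l - 1) - (2 - l) = c" "(m + l - 1) - (2 * (2 - l) + 1) = d"
    unfolding assms(2,4)[symmetric] by (simp_all add: algebra_simps)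
  then show "m + l - 1 \<noteq> 2 - l" "m + l - 1 \<noteq> 2 * (2 - l) + 1"
    using assms(3,5) by (metis right_minus_eq)+
qed

lemma Q_eq_0:
  assumes "x \<in> U 0 0 \<union> U (1/2) (1/2) \<union> U 0 1 \<union> U (-1/2) 0"
  shows "Q x = 0"
  using assms
proof (elim UnE)
  show "x \<in> U 0 0 \<Longrightarrow> Q x = 0"
    by (erule Q_eq_0_if[where c = "-3" and d = "-6"]) simp_all
  show "x \<in> U (1/2) (1/2) \<Longrightarrow> Q x = 0"
    by (erule Q_eq_0_if[where c = "- (3/2)" and d = "-4"]) (simp_all add: field_simps)
  show "x \<in> U 0 1 \<Longrightarrow> Q x = 0"
    by (erule Q_eq_0_if[where c = "-2" and d = "-5"]) simp_all
  show "x \<in> U (-1/2) 0 \<Longrightarrow> Q x = 0"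
    by (erule Q_eq_0_if[where c = "-4" and d = "- (15/2)"]) (simp_all add: field_simps)
qed

text \<open>On such \<open>x\<close> the map \<open>Q / q\<close> is an involution, and
  \<open>y\<close>, \<open>z\<close> are the projections to its eigenvalues 1 and -1.\<close>

lemma UQ_split:
  assumes "x \<in> U l m" "Q (Q x) = scale (q * q) x" "q \<noteq> 0" "Q x \<in> U l m"
  shows "x \<in> span (UQ l m q \<union> UQ l m (-q))"
proof -
  define y where "y = scale (1 / (2 * q)) (scale q x + Q x)"
  define z where "z = scale (1 / (2 * q)) (scale q x - Q x)"
  have "(scale q x + Q x) + (scale q x - Q x) = scale (2 * q) x"
    by (simp only: mult_2 scale_left_distrib) simp
  then have "y + z = scale (1 / (2 * q)) (scale (2 * q) x)"
    unfolding y_def z_def by (simp only: scale_right_distrib[symmetric])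
  then have "x = y + z" using assms(3) by simp
  moreover have "y \<in> UQ l m q" "z \<in> UQ l m (-q)"
    using assms subspace_scale[OF subspace_U] subspace_add[OF subspace_U] subspace_diff[OF subspace_U]
    by (auto simp: y_def z_def peirce_space_Q_def lin_simps scale_right_distrib scale_right_diff_distrib mult.commute mult.left_commute)
  ultimately show ?thesis by (auto intro!: span_add intro: span_base)
qed

lemma UQ_independent:
  assumes "x \<in> UQ l m q" "y \<in> UQ l m (-q)" "q \<noteq> 0" "x + y = 0"
  shows "x = 0" "y = 0"
proof -
  have "y = - x" using assms(4) by (simp add: eq_neg_iff_add_eq_0 add.commute)
  then have "scale q x + scale q x = Q x + Q y"
    using assms(1,2) by (simp only: peirce_space_Q_def mem_Collect_eq scale_minus_left scale_minus_right minus_minus)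
  also have "\<dots> = 0" using \<open>y = - x\<close> by (simp add: lin_simps)
  finally have "scale 2 (scale q x) = 0" by (simp only: scale_numerals)
  then show "x = 0" using assms(3) by simp
  with \<open>y = - x\<close> show "y = 0" by simp
qed

section \<open>The ten summands and the map \<open>\<tau>\<close>\<close>

text \<open>Independence comes in two stages: first over the eight pairs \<open>(l, m)\<close>, then
  between the two \<open>Q\<close>-eigenspaces sharing the pair \<open>(1, 1)\<close> or
  \<open>(1, 3)\<close>.\<close>

lemma peirce_decomposition:
  "is_direct_sum scale
     [U 0 0, U (1/2) (1/2), UQ 1 1 1, UQ 1 1 (-1), U (3/2) (3/2),
      U (-1/2) 0, U 0 1, U (1/2) 2, UQ 1 3 3, UQ 1 3 (-3)]" (is "is_direct_sum scale ?Vs")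
proof (rule is_direct_sumI)
  show "\<forall>V\<in>set ?Vs. subspace V" by (simp add: subspace_U subspace_UQ)
next
  fix x
  have "U 1 1 \<subseteq> span (UQ 1 1 1 \<union> UQ 1 1 (-1))"
    by (auto intro!: UQ_split dest: Q_U[of _ 1 1] Q_Q_U)
  moreover have "U 1 3 \<subseteq> span (UQ 1 3 3 \<union> UQ 1 3 (-3))"
    by (auto intro!: UQ_split dest: Q_U[of _ 1 3] Q_Q_U)
  moreover have "span (UQ 1 1 1 \<union> UQ 1 1 (-1)) \<subseteq> span (\<Union>(set ?Vs))"
    "span (UQ 1 3 3 \<union> UQ 1 3 (-3)) \<subseteq> span (\<Union>(set ?Vs))"
    by (rule span_mono; force)+
  ultimately have "U 1 1 \<subseteq> span (\<Union>(set ?Vs))" "U 1 3 \<subseteq> span (\<Union>(set ?Vs))"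
    by blast+
  then have "peirce_sum \<subseteq> span (\<Union>(set ?Vs))"
    unfolding peirce_sum_def by (intro span_minimal subspace_span Un_least) (auto intro: span_base)
  then show "x \<in> span (\<Union>(set ?Vs))" using mem_peirce_sum by blast
next
  fix xs assume "list_all2 (\<in>) xs ?Vs" and sum: "sum_list xs = 0"
  then obtain a b c d f g h i j k where xs: "xs = [a, b, c, d, f, g, h, i, j, k]"
    and mem: "a \<in> U 0 0" "b \<in> U (1/2) (1/2)" "c \<in> UQ 1 1 1" "d \<in> UQ 1 1 (-1)"
      "f \<in> U (3/2) (3/2)" "g \<in> U (-1/2) 0" "h \<in> U 0 1" "i \<in> U (1/2) 2" "j \<in> UQ 1 3 3" "k \<in> UQ 1 3 (-3)"
    by (auto simp: list_all2_Cons2)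
  let ?I = "{(0, 0), (1/2, 1/2), (1, 1), (3/2, 3/2), (-1/2, 0), (0, 1), (1/2, 2), (1, 3)} :: ('k \<times> 'k) set"
  \<comment> \<open>Components with the same \<open>(l, m)\<close> are merged. The value 0 off
    \<open>?I\<close> is a dummy.\<close>
  define v :: "'k \<times> 'k \<Rightarrow> 'u" where "v = (\<lambda>_. 0)((0, 0) := a, (1/2, 1/2) := b, (1, 1) := c + d, (3/2, 3/2) := f,
     (-1/2, 0) := g, (0, 1) := h, (1/2, 2) := i, (1, 3) := j + k)"
  have neq_if: "a \<noteq> b" if "a - b = c / 2" "c \<noteq> 0" for a b c :: 'k
    using that by auto
  \<comment> \<open>The indices must be distinct in the field, so that no update overwrites another
    and the sum over \<open>?I\<close> has eight terms. The witnesses are twice the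
    differences.\<close>
  have neq: "(1/2 :: 'k) \<noteq> 3/2" "(1/2 :: 'k) \<noteq> -1/2" "(3/2 :: 'k) \<noteq> -1/2" "(3/2 :: 'k) \<noteq> 1"
    "(1/2 :: 'k) \<noteq> 1" "(-1/2 :: 'k) \<noteq> 1" "(3/2 :: 'k) \<noteq> 2" "(1/2 :: 'k) \<noteq> 2"
    by (rule neq_if[of _ _ "-2"] neq_if[of _ _ 2] neq_if[of _ _ 4] neq_if[of _ _ 1] neq_if[of _ _ "-1"]
        neq_if[of _ _ "-3"]; force simp: field_simps)+
  have v: "v (0, 0) = a" "v (1/2, 1/2) = b" "v (1, 1) = c + d" "v (3/2, 3/2) = f"
     "v (-1/2, 0) = g" "v (0, 1) = h" "v (1/2, 2) = i" "v (1, 3) = j + k"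
    using neq by (auto simp: v_def)
  have eig: "L (v p) = scale (fst p) (v p) \<and> R (v p) = scale (snd p) (v p)" if "p \<in> ?I" for p
    using that
    by (elim insertE emptyE; hypsubst; unfold v fst_conv snd_conv; insert mem;
        simp add: peirce_space_def peirce_space_Q_def lin_simps scale_right_distrib)
  have sum_v: "(\<Sum>p\<in>?I. v p) = 0"
    \<comment> \<open>Simplification rewrites \<open>-1/2\<close> to \<open>- (1/2)\<close>, so the
      fifth value is supplied in that form too.\<close>
    using sum neq neq[symmetric] by (simp add: v v(5)[unfolded divide_minus_left] xs add_ac)
  have "v p = 0" if "p \<in> ?I" for p
    using joint_eigenvectors_independent[OF L.linear_axioms R.linear_axioms _ _ sum_v that] eig by auto
  from this[of "(0, 0)"] this[of "(1/2, 1/2)"] this[of "(1, 1)"] this[of "(3/2, 3/2)"] this[of "(-1/2, 0)"]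
    this[of "(0, 1)"] this[of "(1/2, 2)"] this[of "(1, 3)"]
  have "a = 0" "b = 0" "c + d = 0" "f = 0" "g = 0" "h = 0" "i = 0" "j + k = 0"
    by (simp_all add: v v(5)[unfolded divide_minus_left])
  then show "\<forall>x\<in>set xs. x = 0"
    using UQ_independent[of c 1 1 1 d] UQ_independent[of j 1 3 3 k] mem by (simp add: xs)
qed

text \<open>By \<open>Q_U\<close> the two spaces are exchanged, and on both \<open>Q Q\<close> is
  multiplication by \<open>m (m + l - 1) = 3\<close>; hence \<open>Q / s\<close> is its own
  inverse.\<close>

lemma bij_betw_Q:
  assumes "s\<^sup>2 = (3 :: 'k)"
  shows "bij_betw (\<lambda>a. scale (1 / s) (Q a)) (U (3/2) (3/2)) (U (1/2) 2)"
    "bij_betw (\<lambda>a. scale (1 / s) (Q a)) (U (1/2) 2) (U (3/2) (3/2))"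
proof -
  have s: "s \<noteq> 0" using assms by auto
  have inverse: "scale (1 / s) (Q (scale (1 / s) (Q x))) = x" if "x \<in> U (3/2) (3/2) \<union> U (1/2) 2" for x
  proof -
    have "Q (Q x) = scale 3 x"
      using that by (auto dest!: Q_Q_U simp: field_simps)
    then show ?thesis
      using s assms by (simp add: lin_simps power2_eq_square field_simps)
  qed
  have maps: "scale (1 / s) (Q x) \<in> U (1/2) 2" if "x \<in> U (3/2) (3/2)" for x
    using Q_U[OF that] subspace_scale[OF subspace_U] by (simp add: field_simps)
  have maps': "scale (1 / s) (Q x) \<in> U (3/2) (3/2)" if "x \<in> U (1/2) 2" for x
    using Q_U[OF that] subspace_scale[OF subspace_U] by (simp add: field_simps)
  show "bij_betw (\<lambda>a. scale (1 / s) (Q a)) (U (3/2) (3/2)) (U (1/2) 2)"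
    "bij_betw (\<lambda>a. scale (1 / s) (Q a)) (U (1/2) 2) (U (3/2) (3/2))"
    by (rule bij_betw_byWitness[where f' = "\<lambda>a. scale (1 / s) (Q a)"]; use inverse maps maps' in blast)+
qed

section \<open>Weak commutativity\<close>

text \<open>The odd part at 1 and 2 gives \<open>2 b + 2 d = 0\<close> and
  \<open>4 b + 16 d = 0\<close>, hence \<open>12 b = 0\<close>. Only the values 1, -1, 2, -2 of
  \<open>s\<close> enter, so small finite fields are covered.\<close>

lemma linear_coefficient_eq_0:
  assumes "\<And>s. a + scale s b + scale (s^2) c + scale (s^3) d + scale (s^4) f = 0"
  shows "b = 0"
proof -
  let ?p = "\<lambda>s. a + scale s b + scale (s^2) c + scale (s^3) d + scale (s^4) f"
  have "scale 2 b + scale 2 d = ?p 1 - ?p (-1)"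
    by (simp add: scale_numerals)
  then have "scale 2 (b + d) = 0" by (simp only: assms scale_right_distrib) simp
  then have d: "d = - b" by (simp add: eq_neg_iff_add_eq_0 add.commute)
  have "scale 2 b + scale 2 b + (scale 8 d + scale 8 d) = ?p 2 - ?p (-2)" by simp
  also have "\<dots> = 0" by (simp only: assms diff_self)
  finally have "scale (2 + 2 + (- 8 - 8)) b = 0"
    by (simp only: d scale_left_distrib scale_left_diff_distrib scale_minus_left scale_minus_right diff_conv_add_uminus)
  then show ?thesis by simp
qed

text \<open>Weak commutativity is applied to \<open>e + s x\<close> with \<open>e\<close> as the
  other element; the claim is the coefficient of \<open>s\<close>.\<close>

lemma weakly_commutative_linearized:
  assumes "weakly_commutative t"
  shows "R (R x + Q x + L x - x) = L (R x + Q x + L x - x)"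
proof -
  \<comment> \<open>The cube of \<open>e + s x\<close> has coefficients \<open>e\<close>,
    \<open>?S\<close>, \<open>c\<close>, \<open>d\<close>.\<close>
  define c where "c = t e x x + t x e x + t x x e"
  define d where "d = t x x x"
  let ?S = "R x + Q x + L x"
  have "(t e e e - t e e e) + scale s ((L ?S + R x) - (R ?S + L x)) +
      scale (s^2) ((t e e c + t x e ?S) - (t c e e + t ?S e x)) +
      scale (s^3) ((t e e d + t x e c) - (t d e e + t c e x)) +
      scale (s^4) (t x e d - t d e x) = 0" for s
  proof -
    have "t (e + scale s x) (e + scale s x) (e + scale s x) = e + scale s ?S + scale (s^2) c + scale (s^3) d"
      by (simp add: t1.add t2.add t3.add t1.scale t2.scale t3.scale c_def d_def L_op_def R_op_def Q_op_def
        scale_right_distrib power2_eq_square power3_eq_cube eee algebra_simps)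
    then have "t (e + scale s x) e (e + scale s ?S + scale (s^2) c + scale (s^3) d)
      = t (e + scale s ?S + scale (s^2) c + scale (s^3) d) e (e + scale s x)"
      using assms unfolding weakly_commutative_def by metis
    then show ?thesis
      by (simp add: t1.add t2.add t3.add t1.scale t2.scale t3.scale L_op_def R_op_def Q_op_def
        scale_right_distrib scale_right_diff_distrib power2_eq_square power3_eq_cube eval_nat_numeral eee algebra_simps)
  qed
  then have "(L ?S + R x) - (R ?S + L x) = 0" by (rule linear_coefficient_eq_0)
  then show ?thesis by (simp add: lin_simps algebra_simps)
qed

text \<open>Apply \<open>R - L\<close> to \<open>(m + l - 1) x + Q x\<close>, where
  \<open>Q x\<close> has the eigenvalues from \<open>Q_U\<close>.\<close>

lemma weakly_commutative_U:
  assumes "weakly_commutative t" "x \<in> U l m"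
  shows "scale ((m - l) * (m + l - 1)) x = scale (3 - m - 2 * l) (Q x)"
proof -
  define y where "y = R x + Q x + L x - x"
  have y: "y = scale (m + l - 1) x + Q x"
    using assms(2) by (simp add: y_def peirce_space_def scale_left_distrib scale_left_diff_distrib)
  have Rx: "R x = scale m x" "L x = scale l x" using assms(2) by (simp_all add: peirce_space_def)
  have Qx: "R (Q x) = scale (m + l - 1) (Q x)" "L (Q x) = scale (2 - l) (Q x)"
    using Q_U[OF assms(2)] by (simp_all add: peirce_space_def)
  have "R y = L y"
    unfolding y_def by (rule weakly_commutative_linearized[OF assms(1)])
  then have "scale ((m + l - 1) * m) x + scale (m + l - 1) (Q x)
      = scale ((m + l - 1) * l) x + scale (2 - l) (Q x)"
    unfolding y by (simp only: lin_simps Rx Qx scale_scale)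
  then have "scale ((m + l - 1) * m) x - scale ((m + l - 1) * l) x
      = scale (2 - l) (Q x) - scale (m + l - 1) (Q x)"
    by (simp only: diff_eq_eq add_diff_eq diff_add_eq add.commute eq_diff_eq)
  then have "scale ((m + l - 1) * m - (m + l - 1) * l) x = scale (2 - l - (m + l - 1)) (Q x)"
    by (simp only: scale_left_diff_distrib)
  moreover have "(m + l - 1) * m - (m + l - 1) * l = (m - l) * (m + l - 1)" "2 - l - (m + l - 1) = 3 - m - 2 * l"
    by (simp_all add: algebra_simps)
  ultimately show ?thesis by (simp only:)
qed

text \<open>In order: the relation forces \<open>Q x = 0\<close> against \<open>Q Q = 3\<close>;
  \<open>Q x = 0\<close> leaves \<open>-3/4 x = 0\<close>; the coefficient of \<open>Q x\<close> is
  0, leaving \<open>9/4 x = 0\<close>; and \<open>6 x = -2 (3 x)\<close>. For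
  \<open>Q x = -3 x\<close> the last one is trivial, so that summand survives.\<close>

lemma weakly_commutative_vanishing:
  assumes "weakly_commutative t"
  shows "U (3/2) (3/2) = {0}" "U (-1/2) 0 = {0}" "U (1/2) 2 = {0}" "UQ 1 3 3 = {0}"
proof -
  note wc = weakly_commutative_U[OF assms]
  have 1: "x = 0" if "x \<in> U (3/2) (3/2)" for x
  proof -
    have coeff: "3 - 3/2 - 2 * (3/2) = (- (3/2) :: 'k)" by (simp add: field_simps)
    have "Q x = 0" using wc[OF that] unfolding coeff by simp
    moreover have "(3/2) * (3/2 + 3/2 - 1) = (3 :: 'k)" by (simp add: field_simps)
    ultimately show ?thesis using Q_Q_U[OF that] by simp
  qed
  have 2: "x = 0" if "x \<in> U (-1/2) 0" for x
  proof -
    have coeff: "(0 - - 1/2) * (0 + - 1/2 - 1) = (- (3/4) :: 'k)" by (simp add: field_simps)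
    show ?thesis using wc[OF that] Q_eq_0[of x] that unfolding coeff by simp
  qed
  have 3: "x = 0" if "x \<in> U (1/2) 2" for x
  proof -
    have coeff: "(2 - 1/2) * (2 + 1/2 - 1) = (9/4 :: 'k)" "3 - 2 - 2 * (1/2) = (0 :: 'k)"
      by (simp_all add: field_simps)
    show ?thesis using wc[OF that] unfolding coeff by simp
  qed
  have 4: "x = 0" if "x \<in> UQ 1 3 3" for x
  proof -
    have "scale 6 x = scale (-2) (scale 3 x)"
      using wc[of x 1 3] that by (simp add: peirce_space_Q_def)
    then have "scale (6 - (-2) * 3) x = 0"
      by (simp only: scale_left_diff_distrib scale_scale) simp
    then show ?thesis by simp
  qed
  have zero: "0 \<in> U l m" "0 \<in> UQ l m q" for l m q
    using subspace_0[OF subspace_U] subspace_0[OF subspace_UQ] by blast+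
  show "U (3/2) (3/2) = {0}" using 1 zero(1) by blast
  show "U (-1/2) 0 = {0}" using 2 zero(1) by blast
  show "U (1/2) 2 = {0}" using 3 zero(1) by blast
  show "UQ 1 3 3 = {0}" using 4 zero(2) by blast
qed

lemma weakly_commutative_decomposition:
  assumes "weakly_commutative t"
  shows "is_direct_sum scale [U 0 0, U (1/2) (1/2), UQ 1 1 1, UQ 1 1 (-1), U 0 1, UQ 1 3 (-3)]"
proof -
  \<comment> \<open>Each splitting of the list exposes the next zero summand to be removed.\<close>
  have "is_direct_sum scale ([U 0 0, U (1/2) (1/2), UQ 1 1 1, UQ 1 1 (-1)] @ {0} #
      [{0}, U 0 1, {0}, {0}, UQ 1 3 (-3)])"
    using peirce_decomposition unfolding weakly_commutative_vanishing[OF assms] by simp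
  then have "is_direct_sum scale ([U 0 0, U (1/2) (1/2), UQ 1 1 1, UQ 1 1 (-1)] @ {0} #
      [U 0 1, {0}, {0}, UQ 1 3 (-3)])"
    by (drule_tac is_direct_sum_remove_zero) simp
  then have "is_direct_sum scale ([U 0 0, U (1/2) (1/2), UQ 1 1 1, UQ 1 1 (-1), U 0 1] @ {0} #
      [{0}, UQ 1 3 (-3)])"
    by (drule_tac is_direct_sum_remove_zero) simp
  then have "is_direct_sum scale ([U 0 0, U (1/2) (1/2), UQ 1 1 1, UQ 1 1 (-1), U 0 1] @ {0} #
      [UQ 1 3 (-3)])"
    by (drule_tac is_direct_sum_remove_zero) simp
  then show ?thesis by (drule_tac is_direct_sum_remove_zero) simp
qed

end

theorem theorem1p3:
  fixes scale :: "'k::field \<Rightarrow> 'u::ab_group_add \<Rightarrow> 'u"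
    and t :: "'u \<Rightarrow> 'u \<Rightarrow> 'u \<Rightarrow> 'u"
    and e :: 'u
    and L R Q :: "'u \<Rightarrow> 'u"
    and U :: "'k \<Rightarrow> 'k \<Rightarrow> 'u set"
    and UQ :: "'k \<Rightarrow> 'k \<Rightarrow> 'k \<Rightarrow> 'u set"
  defines "L \<equiv> L_op t e"
    and "R \<equiv> R_op t e"
    and "Q \<equiv> Q_op t e"
    and "U \<equiv> peirce_space scale t e"
    and "UQ \<equiv> peirce_space_Q scale t e"
  assumes "gen_jordan_triple_2 scale t"
    and "CHAR('k) \<notin> {2, 3, 5}"
    and "tripotent t e"
  shows
    "is_direct_sum scale
       [U 0 0, U (1/2) (1/2), UQ 1 1 1, UQ 1 1 (-1), U (3/2) (3/2),
        U (-1/2) 0, U 0 1, U (1/2) 2, UQ 1 3 3, UQ 1 3 (-3)]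
     \<and> (\<forall>(l, m) \<in> {(0, 0), (1/2, 1/2), (3/2, 3/2), (-1/2, 0), (0, 1), (1/2, 2)}.
          \<forall>a \<in> U l m. L a = scale l a \<and> R a = scale m a)
     \<and> (\<forall>(l, m, q) \<in> {(1, 1, 1), (1, 1, -1), (1, 3, 3), (1, 3, -3)}.
          \<forall>a \<in> UQ l m q. L a = scale l a \<and> R a = scale m a)
     \<and> (\<forall>a \<in> U 0 0 \<union> U (1/2) (1/2) \<union> U 0 1 \<union> U (-1/2) 0. Q a = 0)
     \<and> (\<forall>a \<in> UQ 1 1 1. Q a = a)
     \<and> (\<forall>a \<in> UQ 1 1 (-1). Q a = - a)
     \<and> (\<forall>a \<in> UQ 1 3 3. Q a = scale 3 a)
     \<and> (\<forall>a \<in> UQ 1 3 (-3). Q a = - scale 3 a)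
     \<and> (\<forall>s :: 'k. s ^ 2 = 3 \<longrightarrow>
          bij_betw (\<lambda>a. scale (1 / s) (Q a)) (U (3/2) (3/2)) (U (1/2) 2) \<and>
          bij_betw (\<lambda>a. scale (1 / s) (Q a)) (U (1/2) 2) (U (3/2) (3/2)))
     \<and> (weakly_commutative t \<longrightarrow>
          is_direct_sum scale
            [U 0 0, U (1/2) (1/2), UQ 1 1 1, UQ 1 1 (-1), U 0 1, UQ 1 3 (-3)]
          \<and> (\<forall>(l, m) \<in> {(0, 0), (1/2, 1/2), (0, 1)}.
               \<forall>a \<in> U l m. L a = scale l a \<and> R a = scale m a)
          \<and> (\<forall>(l, m, q) \<in> {(1, 1, 1), (1, 1, -1), (1, 3, -3)}.
               \<forall>a \<in> UQ l m q. L a = scale l a \<and> R a = scale m a)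
          \<and> (\<forall>a \<in> U 0 0 \<union> U (1/2) (1/2) \<union> U 0 1. Q a = 0)
          \<and> (\<forall>a \<in> UQ 1 1 1. Q a = a)
          \<and> (\<forall>a \<in> UQ 1 1 (-1). Q a = - a)
          \<and> (\<forall>a \<in> UQ 1 3 (-3). Q a = - scale 3 a))"
proof -
  interpret gen_jordan_triple_2 scale t by (fact assms)
  \<comment> \<open>Otherwise the characteristic divides \<open>n\<close>, so it is at most 5. Then
    0 and 4 do not divide \<open>n\<close>, 1 never occurs, and 2, 3, 5 are excluded by
    hypothesis.\<close>
  have nonzero: "(of_nat n :: 'k) \<noteq> 0" if n: "n \<in> {2, 3, 5}" for n
  proof
    assume "(of_nat n :: 'k) = 0"
    then have dvd: "CHAR('k) dvd n" by (simp only: of_nat_eq_0_iff_char_dvd)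
    with n have "CHAR('k) \<le> 5" by (auto dest!: dvd_imp_le)
    then have "CHAR('k) \<in> {0, 1, 2, 3, 4, 5}" by (simp only: insert_iff empty_iff) arith
    with n dvd assms(7) CHAR_not_1[where 'a = 'k] show False by auto
  qed
  interpret peirce scale t e
    using nonzero[of 2] nonzero[of 3] nonzero[of 5] assms(8)
    by unfold_locales (simp_all add: tripotent_def)
  show ?thesis
    unfolding L_def R_def Q_def U_def UQ_def
    using peirce_decomposition weakly_commutative_decomposition bij_betw_Q Q_eq_0
    by (auto simp: peirce_space_def peirce_space_Q_def)
qed

end
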